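(* Let $L=(L,\le)$ be a finite lattice with top element $T$. The c-independent subsets of $L$ are exactly the pushes of (c-independent, strict) chains of $L$: a subset $W\subseteq L$ is c-independent if and only if it is a push of some c-independent strict chain of $L$ with respect to some witness of that chain. More precisely, if $W=\{\ell_1,\dots,\ell_k\}$ is c-independent with witness $U=\{m_1,\dots,m_k\}$ and $\tilde m_j:=m_j\wedge m_{j+1}\wedge\cdots\wedge m_k$ for $j=1,\dots,k$, then $$\tilde m_1<\tilde m_2<\cdots<\tilde m_k<T$$ is a strict chain, the set consisting of $\tilde m_2<\tilde m_3<\cdots<\tilde m_k<T$ is c-independent with witness $\{\tilde m_1,\dots,\tilde m_k\}$, and $\{\ell_1,\dots,\ell_k\}$ is a push of this chain with respect to this witness.
   Context: The superboolean semiring is $\mathbb{SB}=\{0,1,1^\nu\}$ with commutative operations: $0+x=x$ for all $x$, $1+1=1+1^\nu=1^\nu+1^\nu=1^\nu$; $0\cdot x=0$, $1\cdot x=x$, $1^\nu\cdot 1^\nu=1^\nu$. Vectors $v_1,\dots,v_m\in\mathbb{SB}^{n}$ are dependent if there are $\alpha_1,\dots,\alpha_m\in\{0,1\}$, not all $0$, with $\alpha_1v_1+\cdots+\alpha_mv_m\in\{0,1^\nu\}^{n}$; otherwise they are independent. For a finite lattice $L$ let $D$ be the matrix over $\mathbb{SB}$ with rows and columns indexed by $L$, whose entry in row $m$ and column $\ell$ is $1$ if $\ell\not\le m$ and $0$ if $\ell\le m$. A subset $W\subseteq L$ is c-independent if the columns of $D$ indexed by $W$ are independent. A witness of a $k$-element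 subset $W\subseteq L$ is a $k$-element set $U\subseteq L$ such that the submatrix of $D$ with rows $U$ and columns $W$ is nonsingular, i.e. its permanent, computed in $\mathbb{SB}$, equals $1$. Equivalently, the elements can be indexed as $W=\{\ell_1,\dots,\ell_k\}$, $U=\{m_1,\dots,m_k\}$ so that $\ell_i\not\le m_i$ for all $i$ and $\ell_i\le m_j$ for all $i<j$; when a witness is listed as $m_1,\dots,m_k$ together with $W=\{\ell_1,\dots,\ell_k\}$, such a matching indexing is meant. (A subset is c-independent iff it has a witness.) A push of $W=\{\ell_1,\dots,\ell_k\}$ with respect to its witness $U=\{m_1,\dots,m_k\}$ is a subset $\{\tilde\ell_1,\dots,\tilde\ell_k\}\subseteq L$ with $\tilde\ell_i\le\ell_i$ and $\tilde\ell_i\not\le m_i$ for every $i=1,\dots,k$. *)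

theory Defs
  imports Main "HOL-Library.FuncSet"
begin

text \<open>The superboolean semiring; \<open>SBnu\<close> is the ghost element $1^\nu$.\<close>

datatype superboolean = SBzero | SBone | SBnu

instantiation superboolean :: comm_semiring_1
begin

definition zero_superboolean :: superboolean where "0 = SBzero"

definition one_superboolean :: superboolean where "1 = SBone"

fun plus_superboolean :: "superboolean \<Rightarrow> superboolean \<Rightarrow> superboolean" where
  "SBzero + y = y"
| "x + SBzero = x"
| "_ + _ = SBnu"

fun times_superboolean :: "superboolean \<Rightarrow> superboolean \<Rightarrow> superboolean" where
  "SBzero * _ = SBzero"
| "_ * SBzero = SBzero"
| "SBone * y = y"
| "x * SBone = x"
| "SBnu * SBnu = SBnu"

instance
proof
  fix a b c :: superboolean
  show "a + b + c = a + (b + c)" by (cases a; cases b; cases c; simp)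
  show "a + b = b + a" by (cases a; cases b; simp)
  show "0 + a = a" by (simp add: zero_superboolean_def)
  show "a * b * c = a * (b * c)" by (cases a; cases b; cases c; simp)
  show "a * b = b * a" by (cases a; cases b; simp)
  show "1 * a = a" by (cases a; simp add: one_superboolean_def)
  show "(a + b) * c = a * c + b * c" by (cases a; cases b; cases c; simp)
  show "0 * a = 0" by (simp add: zero_superboolean_def)
  show "a * 0 = 0" by (cases a; simp add: zero_superboolean_def)
  show "(0::superboolean) \<noteq> 1" by (simp add: zero_superboolean_def one_superboolean_def)
qed

end

text \<open>Vectors are functions on an index type; \<open>v\<close> is a family of vectors indexed by the finite
  set \<open>I\<close>.\<close>

definition sb_dependent :: "'i set \<Rightarrow> ('i \<Rightarrow> 'r \<Rightarrow> superboolean) \<Rightarrow> bool" where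
  "sb_dependent I v \<longleftrightarrow>
     (\<exists>\<alpha>. (\<forall>i\<in>I. \<alpha> i \<in> {0, 1}) \<and> (\<exists>i\<in>I. \<alpha> i \<noteq> 0) \<and>
          (\<forall>r. (\<Sum>i\<in>I. \<alpha> i * v i r) \<in> {0, SBnu}))"

abbreviation sb_independent :: "'i set \<Rightarrow> ('i \<Rightarrow> 'r \<Rightarrow> superboolean) \<Rightarrow> bool" where
  "sb_independent I v \<equiv> \<not> sb_dependent I v"

text \<open>Permanent of the submatrix with rows \<open>R\<close> and columns \<open>C\<close>, two finite sets of the same
  cardinality that come without a numbering: the sum runs over all bijections from \<open>C\<close> to \<open>R\<close>.
  These are taken in \<open>extensional C\<close> so that each bijection is counted once.\<close>

definition permanent :: "('r \<Rightarrow> 'c \<Rightarrow> 'b::comm_semiring_1) \<Rightarrow> 'r set \<Rightarrow> 'c set \<Rightarrow> 'b" where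
  "permanent A R C =
     (\<Sum>\<sigma>\<in>{\<sigma> \<in> extensional C. bij_betw \<sigma> C R}. \<Prod>c\<in>C. A (\<sigma> c) c)"

definition sb_nonsingular :: "('r \<Rightarrow> 'c \<Rightarrow> superboolean) \<Rightarrow> 'r set \<Rightarrow> 'c set \<Rightarrow> bool" where
  "sb_nonsingular A R C \<longleftrightarrow> permanent A R C = 1"

definition lattice_matrix :: "'a::order \<Rightarrow> 'a \<Rightarrow> superboolean" where
  "lattice_matrix m l = (if l \<le> m then 0 else 1)"

definition c_independent :: "'a::{finite, lattice} set \<Rightarrow> bool" where
  "c_independent W \<longleftrightarrow> sb_independent W (\<lambda>l m. lattice_matrix m l)"

definition witness :: "'a::{finite, lattice} set \<Rightarrow> 'a set \<Rightarrow> bool" where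
  "witness W U \<longleftrightarrow> card U = card W \<and> sb_nonsingular lattice_matrix U W"

text \<open>\<open>U = {m\<^sub>1, \<dots>, m\<^sub>k}\<close> is a witness of \<open>W = {l\<^sub>1, \<dots>, l\<^sub>k}\<close>, both sets being listed
  without repetition in a matching order. Listings are functions of which only the values on
  \<open>{1..k}\<close> matter.\<close>

definition witness_listing ::
  "nat \<Rightarrow> (nat \<Rightarrow> 'a::{finite, lattice}) \<Rightarrow> (nat \<Rightarrow> 'a) \<Rightarrow> 'a set \<Rightarrow> 'a set \<Rightarrow> bool" where
  "witness_listing k l m W U \<longleftrightarrow>
     witness W U \<and> bij_betw l {1..k} W \<and> bij_betw m {1..k} U \<and>
     (\<forall>i\<in>{1..k}. \<not> l i \<le> m i) \<and>
     (\<forall>i\<in>{1..k}. \<forall>j\<in>{1..k}. i < j \<longrightarrow> l i \<le> m j)"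

text \<open>\<open>V\<close> is a push of \<open>W\<close> with respect to its witness \<open>U\<close>. The choice of the listing is
  immaterial: nonsingularity leaves only one possible pairing of \<open>l i\<close> with \<open>m i\<close>.\<close>

definition push :: "'a::{finite, lattice} set \<Rightarrow> 'a set \<Rightarrow> 'a set \<Rightarrow> bool" where
  "push V W U \<longleftrightarrow>
     (\<exists>k l m l'. witness_listing k l m W U \<and> V = l' ` {1..k} \<and>
        (\<forall>i\<in>{1..k}. l' i \<le> l i \<and> \<not> l' i \<le> m i))"

definition tail_meet :: "nat \<Rightarrow> (nat \<Rightarrow> 'a::lattice) \<Rightarrow> nat \<Rightarrow> 'a" where
  "tail_meet k m j = Inf_fin (m ` {j..k})"

text \<open>The listing, on \<open>{1..k}\<close>, of the chain consisting of the tail meets number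
  \<open>2, \<dots>, k\<close> followed by the top element. For \<open>k = 0\<close> it lists the empty set.\<close>

definition tail_meet_chain :: "nat \<Rightarrow> (nat \<Rightarrow> 'a::bounded_lattice_top) \<Rightarrow> nat \<Rightarrow> 'a" where
  "tail_meet_chain k m i = (if i < k then tail_meet k m (Suc i) else top)"

end

theory Submission imports Defs begin

text \<open>
  Both halves of the statement reduce to \<^emph>\<open>triangular\<close> listings, i.e. families with
  \<open>\<not> l i \<le> m i\<close> and \<open>l i \<le> m j\<close> for \<open>i < j\<close>. Over the superboolean semiring a sum of zeros
  and ones is neither zero nor a ghost exactly when it has one nonzero term. Hence a set is
  c-independent iff, for each of its nonempty subsets, some row of the matrix has a single nonzero
  entry in the columns of that subset; splitting off such columns one after the other produces a
  triangular listing (\<open>triangular_exists\<close>). Conversely, in a triangular listing the last column of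
  any subfamily has the only nonzero entry in its row (\<open>triangular_c_independent\<close>), and a
  triangular matrix has only the diagonal term in its permanent (\<open>triangular_permanent\<close>).

  With this, the theorem is about order relations only. Lowering \<open>l i\<close> while keeping
  \<open>\<not> l i \<le> m i\<close> preserves triangularity, so pushes are c-independent. In the opposite direction,
  \<open>l i\<close> lies below all \<open>m j\<close> with \<open>j > i\<close>, so it lies below their meet, the tail meet number
  \<open>i + 1\<close>, but not below the tail meet number \<open>i\<close>. Thus \<open>l i\<close> itself shows that the tail meets
  increase strictly, and that it is a push of the next tail meet. For the last index, the empty
  meet is the top element.
\<close>

section \<open>Triangular listings\<close>

definition triangular :: "nat \<Rightarrow> (nat \<Rightarrow> 'a::order) \<Rightarrow> (nat \<Rightarrow> 'a) \<Rightarrow> bool" where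
  "triangular k l m \<longleftrightarrow>
     (\<forall>i\<in>{1..k}. \<not> l i \<le> m i) \<and> (\<forall>i\<in>{1..k}. \<forall>j\<in>{1..k}. i < j \<longrightarrow> l i \<le> m j)"

lemma triangularD:
  assumes "triangular k l m" and "i \<in> {1..k}"
  shows "\<not> l i \<le> m i" and "j \<in> {1..k} \<Longrightarrow> i < j \<Longrightarrow> l i \<le> m j"
  using assms by (auto simp: triangular_def)

lemma triangular_inj:
  assumes "triangular k l m"
  shows "inj_on l {1..k}" and "inj_on m {1..k}"
proof -
  show "inj_on l {1..k}"
  proof (rule linorder_inj_onI')
    fix i j assume ij: "i \<in> {1..k}" "j \<in> {1..k}" "i < j"
    have "l i \<le> m j" "\<not> l j \<le> m j" using triangularD[OF assms] ij by blast+
    thus "l i \<noteq> l j" by metis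
  qed
  show "inj_on m {1..k}"
  proof (rule linorder_inj_onI')
    fix i j assume ij: "i \<in> {1..k}" "j \<in> {1..k}" "i < j"
    have "l i \<le> m j" "\<not> l i \<le> m i" using triangularD[OF assms] ij by blast+
    thus "m i \<noteq> m j" by metis
  qed
qed

text \<open>A bijection contributing to the permanent can only send \<open>l i\<close> to some \<open>m j\<close> with \<open>j \<le> i\<close>;
  by injectivity and strong induction it then sends every \<open>l i\<close> to \<open>m i\<close>.\<close>

lemma triangular_matching_unique:
  assumes tri: "triangular k l m"
    and bij: "bij_betw \<sigma> (l ` {1..k}) (m ` {1..k})"
    and nz: "\<forall>c\<in>l ` {1..k}. \<not> c \<le> \<sigma> c"
    and "i \<in> {1..k}"
  shows "\<sigma> (l i) = m i"
  using \<open>i \<in> {1..k}\<close>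
proof (induction i rule: less_induct)
  case (less i)
  have "\<sigma> (l i) \<in> m ` {1..k}"
    using bij less.prems by (auto simp: bij_betw_def)
  then obtain j where j: "j \<in> {1..k}" "\<sigma> (l i) = m j" by blast
  have "\<not> l i \<le> m j" using nz less.prems j(2) by (metis imageI)
  hence "j \<le> i" using triangularD(2)[OF tri less.prems j(1)] by (meson not_le)
  moreover have "\<not> j < i"
  proof
    assume "j < i"
    hence "\<sigma> (l j) = \<sigma> (l i)" using less.IH j by simp
    hence "l j = l i"
      using bij j(1) less.prems by (auto simp: bij_betw_def dest: inj_onD)
    hence "j = i" using triangular_inj(1)[OF tri] j(1) less.prems by (meson inj_onD)
    with \<open>j < i\<close> show False by simp
  qed
  ultimately show ?case using j by simp
qed

lemma triangular_permanent:
  fixes l m :: "nat \<Rightarrow> 'a::{finite, order}"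
  assumes tri: "triangular k l m"
  shows "permanent lattice_matrix (m ` {1..k}) (l ` {1..k}) = 1"
proof -
  let ?W = "l ` {1..k}" and ?U = "m ` {1..k}"
  let ?B = "{\<sigma> \<in> extensional ?W. bij_betw \<sigma> ?W ?U}"
  let ?p = "\<lambda>\<sigma>. \<Prod>c\<in>?W. lattice_matrix (\<sigma> c) c"
  define \<delta> where "\<delta> = restrict (m \<circ> inv_into {1..k} l) ?W"
  have \<delta>: "\<delta> (l i) = m i" if "i \<in> {1..k}" for i
    using that triangular_inj(1)[OF tri] by (simp add: \<delta>_def)
  have "bij_betw (m \<circ> inv_into {1..k} l) ?W ?U"
    using triangular_inj[OF tri]
    by (intro bij_betw_trans[of _ _ "{1..k}"] bij_betw_inv_into) (simp_all add: bij_betw_def)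
  hence "bij_betw \<delta> ?W ?U"
    unfolding \<delta>_def by (rule bij_betw_cong[THEN iffD1, rotated]) simp
  hence \<delta>B: "\<delta> \<in> ?B" by (simp add: \<delta>_def)
  have off: "?p \<sigma> = 0" if "\<sigma> \<in> ?B - {\<delta>}" for \<sigma>
  proof -
    have "\<exists>c\<in>?W. c \<le> \<sigma> c"
    proof (rule ccontr)
      assume "\<not> (\<exists>c\<in>?W. c \<le> \<sigma> c)"
      hence "\<sigma> (l i) = \<delta> (l i)" if "i \<in> {1..k}" for i
        using triangular_matching_unique[OF tri, of \<sigma>] \<open>\<sigma> \<in> ?B - {\<delta>}\<close> \<delta> that by auto
      hence "\<sigma> = \<delta>"
        using \<open>\<sigma> \<in> ?B - {\<delta>}\<close> \<delta>B by (intro extensionalityI[of _ ?W]) auto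
      with that show False by simp
    qed
    then obtain c where "c \<in> ?W" "c \<le> \<sigma> c" by blast
    hence "\<exists>c\<in>?W. lattice_matrix (\<sigma> c) c = 0"
      unfolding lattice_matrix_def by auto
    thus ?thesis by (intro prod_zero) simp_all
  qed
  have "permanent lattice_matrix ?U ?W = (\<Sum>\<sigma>\<in>?B. ?p \<sigma>)"
    by (simp add: permanent_def)
  also have "\<dots> = (\<Sum>\<sigma>\<in>{\<delta>}. ?p \<sigma>)"
    by (rule sum.mono_neutral_right) (use \<delta>B off in auto)
  also have "\<dots> = ?p \<delta>" by simp
  also have "?p \<delta> = 1"
    using \<delta> triangularD(1)[OF tri]
    by (intro prod.neutral) (auto simp: lattice_matrix_def)
  finally show ?thesis .
qed

lemma triangular_witness_listing:
  assumes "triangular k l m"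
  shows "witness_listing k l m (l ` {1..k}) (m ` {1..k})"
  unfolding witness_listing_def witness_def sb_nonsingular_def
  using assms triangular_inj[OF assms] triangular_permanent[OF assms]
  by (auto simp: bij_betw_def card_image triangular_def)

lemma witness_listing_triangular:
  assumes "witness_listing k l m W U"
  shows "triangular k l m" and "l ` {1..k} = W"
  using assms by (auto simp: witness_listing_def triangular_def bij_betw_def)

section \<open>Independence as triangularity\<close>

lemma of_nat_superboolean: "(of_nat n \<in> {0, SBnu}) = (n \<noteq> 1)"
proof -
  have ge2: "of_nat (Suc (Suc j)) = SBnu" for j
    by (induction j) (simp_all add: one_superboolean_def zero_superboolean_def)
  consider "n = 0" | "n = 1" | j where "n = Suc (Suc j)"
    by (metis One_nat_def not0_implies_Suc)
  thus ?thesis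
  proof cases
    case 3
    thus ?thesis using ge2[of j] by (simp del: of_nat_Suc)
  qed (simp_all add: zero_superboolean_def one_superboolean_def)
qed

text \<open>Coefficients in \<open>{0, 1}\<close> amount to the choice of a subset of the columns, and the resulting
  sum only counts the nonzero entries of a row in these columns.\<close>

lemma c_independent_iff:
  "c_independent W \<longleftrightarrow> (\<forall>S\<subseteq>W. S \<noteq> {} \<longrightarrow> (\<exists>m. card {l\<in>S. \<not> l \<le> m} = 1))"
proof -
  have count: "(\<Sum>l\<in>W. \<alpha> l * lattice_matrix m l)
      = of_nat (card {l \<in> {l\<in>W. \<alpha> l \<noteq> 0}. \<not> l \<le> m})"
    if "\<forall>l\<in>W. \<alpha> l \<in> {0, 1}" for \<alpha> m
  proof -
    have "(\<Sum>l\<in>W. \<alpha> l * lattice_matrix m l)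
        = (\<Sum>l\<in>W. if \<alpha> l \<noteq> 0 \<and> \<not> l \<le> m then 1 else 0)"
      using that by (intro sum.cong) (auto simp: lattice_matrix_def)
    also have "\<dots> = of_nat (card {l \<in> {l\<in>W. \<alpha> l \<noteq> 0}. \<not> l \<le> m})"
      by (simp flip: sum.inter_filter)
    finally show ?thesis .
  qed
  show ?thesis
  proof
    assume ind: "c_independent W"
    show "\<forall>S\<subseteq>W. S \<noteq> {} \<longrightarrow> (\<exists>m. card {l\<in>S. \<not> l \<le> m} = 1)"
    proof (intro allI impI)
      fix S assume S: "S \<subseteq> W" "S \<noteq> {}"
      define \<alpha> :: "'a \<Rightarrow> superboolean" where "\<alpha> = (\<lambda>l. if l \<in> S then 1 else 0)"
      have \<alpha>: "\<forall>l\<in>W. \<alpha> l \<in> {0, 1}" "{l\<in>W. \<alpha> l \<noteq> 0} = S" "\<exists>l\<in>W. \<alpha> l \<noteq> 0"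
        using S by (auto simp: \<alpha>_def)
      then obtain m where "(\<Sum>l\<in>W. \<alpha> l * lattice_matrix m l) \<notin> {0, SBnu}"
        using ind unfolding c_independent_def sb_dependent_def by blast
      thus "\<exists>m. card {l\<in>S. \<not> l \<le> m} = 1"
        unfolding count[OF \<alpha>(1)] \<alpha>(2) of_nat_superboolean by blast
    qed
  next
    assume *: "\<forall>S\<subseteq>W. S \<noteq> {} \<longrightarrow> (\<exists>m. card {l\<in>S. \<not> l \<le> m} = 1)"
    show "c_independent W"
      unfolding c_independent_def sb_dependent_def
    proof (rule notI, elim exE conjE)
      fix \<alpha> :: "'a \<Rightarrow> superboolean"
      assume \<alpha>: "\<forall>l\<in>W. \<alpha> l \<in> {0, 1}" "\<exists>l\<in>W. \<alpha> l \<noteq> 0"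
        and dep: "\<forall>m. (\<Sum>l\<in>W. \<alpha> l * lattice_matrix m l) \<in> {0, SBnu}"
      obtain m where "card {l \<in> {l\<in>W. \<alpha> l \<noteq> 0}. \<not> l \<le> m} = 1"
        using *[rule_format, of "{l\<in>W. \<alpha> l \<noteq> 0}"] \<alpha>(2) by blast
      moreover have "card {l \<in> {l\<in>W. \<alpha> l \<noteq> 0}. \<not> l \<le> m} \<noteq> 1"
        using dep[rule_format, of m] unfolding count[OF \<alpha>(1)] of_nat_superboolean .
      ultimately show False by contradiction
    qed
  qed
qed

text \<open>In row \<open>m j\<close> every column before \<open>l j\<close> has a zero, so for a subset \<open>S\<close> the row that belongs
  to the last column of \<open>S\<close> has exactly one nonzero entry in \<open>S\<close>.\<close>

lemma triangular_c_independent: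
  assumes tri: "triangular k l m"
  shows "c_independent (l ` {1..k})"
  unfolding c_independent_iff
proof (intro allI impI)
  fix S assume S: "S \<subseteq> l ` {1..k}" "S \<noteq> {}"
  define I where "I = {i\<in>{1..k}. l i \<in> S}"
  have I: "finite I" "I \<noteq> {}" using S by (auto simp: I_def)
  define j where "j = Max I"
  have j: "j \<in> {1..k}" "l j \<in> S" using Max_in[OF I] by (auto simp: I_def j_def)
  have "x \<le> m j" if x: "x \<in> S" "x \<noteq> l j" for x
  proof -
    obtain i where i: "i \<in> {1..k}" "x = l i" using x S by blast
    hence "i \<le> j" using Max_ge[OF I(1), of i] x by (auto simp: I_def j_def)
    hence "i < j" using x i by (cases "i = j") auto
    thus ?thesis using triangularD(2)[OF tri i(1) j(1)] i by simp
  qed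
  hence "{x\<in>S. \<not> x \<le> m j} = {l j}" using j triangularD(1)[OF tri j(1)] by auto
  hence "card {x\<in>S. \<not> x \<le> m j} = 1" by simp
  thus "\<exists>r. card {x\<in>S. \<not> x \<le> r} = 1" by blast
qed

text \<open>A row with a single nonzero entry, in column \<open>x\<close> say, makes \<open>x\<close> a possible last column of
  the listing, and subsets of c-independent sets are again c-independent.\<close>

lemma triangular_exists:
  assumes "c_independent W"
  shows "\<exists>l m. triangular (card W) l m \<and> l ` {1..card W} = W"
  using assms
proof (induction "card W" arbitrary: W)
  case 0
  thus ?case by (auto simp: triangular_def)
next
  case (Suc k)
  have "W \<noteq> {}" using Suc.hyps(2) by auto
  then obtain r where "card {l\<in>W. \<not> l \<le> r} = 1"
    using Suc.prems unfolding c_independent_iff by blast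
  then obtain x where x: "{l\<in>W. \<not> l \<le> r} = {x}" by (auto simp: card_1_singleton_iff)
  have "x \<in> W" using x by blast
  have card: "k = card (W - {x})"
    unfolding card_Diff_singleton[OF \<open>x \<in> W\<close>] Suc.hyps(2)[symmetric] by simp
  have "c_independent (W - {x})"
    using Suc.prems unfolding c_independent_iff by blast
  then obtain l m where lm: "triangular k l m" "l ` {1..k} = W - {x}"
    using Suc.hyps(1)[OF card] card by metis
  have eq: "{1..Suc k} = insert (Suc k) {1..k}" by auto
  have below: "l i \<le> r" if "i \<in> {1..k}" for i
  proof -
    have "l i \<in> W - {x}" using lm(2) that by blast
    thus ?thesis using x by blast
  qed
  have "\<not> x \<le> r" using x by blast
  hence "triangular (Suc k) (l(Suc k := x)) (m(Suc k := r))"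
    using triangularD[OF lm(1)] below by (auto simp: triangular_def)
  moreover have "(l(Suc k := x)) ` {1..Suc k} = insert x (l ` {1..k})"
    unfolding eq by auto
  hence "(l(Suc k := x)) ` {1..Suc k} = W" using lm(2) insert_Diff[OF \<open>x \<in> W\<close>] by simp
  ultimately show ?case using Suc.hyps(2) by metis
qed

section \<open>Pushes and tail meets\<close>

lemma triangular_lower:
  assumes "triangular k l m" and "\<forall>i\<in>{1..k}. l' i \<le> l i \<and> \<not> l' i \<le> m i"
  shows "triangular k l' m"
  using assms unfolding triangular_def by (meson order_trans)

lemma push_c_independent:
  assumes "push V W U"
  shows "c_independent V"
proof -
  obtain k l m l' where lm: "witness_listing k l m W U" and V: "V = l' ` {1..k}"
    and l': "\<forall>i\<in>{1..k}. l' i \<le> l i \<and> \<not> l' i \<le> m i"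
    using assms unfolding push_def by blast
  have "triangular k l' m"
    by (rule triangular_lower[OF witness_listing_triangular(1)[OF lm] l'])
  thus ?thesis unfolding V by (rule triangular_c_independent)
qed

lemma tail_meet_le:
  assumes "j \<le> i" and "i \<le> k"
  shows "tail_meet k m j \<le> m i"
  unfolding tail_meet_def using assms by (intro Inf_fin.coboundedI) auto

lemma tail_meet_greatest:
  assumes "j \<le> k" and "\<And>i. j \<le> i \<Longrightarrow> i \<le> k \<Longrightarrow> x \<le> m i"
  shows "x \<le> tail_meet k m j"
  unfolding tail_meet_def using assms by (intro Inf_fin.boundedI) auto

lemma tail_meet_mono:
  assumes "i \<le> j" and "j \<le> k"
  shows "tail_meet k m i \<le> tail_meet k m j"
  using assms by (intro tail_meet_greatest tail_meet_le) auto

lemma not_le_tail_meet: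
  assumes "triangular k l m" and "i \<in> {1..k}"
  shows "\<not> l i \<le> tail_meet k m i"
  using triangularD(1)[OF assms] tail_meet_le[of i i k m] assms(2) by (auto dest: order_trans)

lemma le_later_tail_meet:
  assumes "triangular k l m" and "i \<in> {1..k}" and "j \<in> {1..k}" and "i < j"
  shows "l i \<le> tail_meet k m j"
  using assms triangularD(2)[OF assms(1,2)] by (intro tail_meet_greatest) auto

lemma strict_mono_on_tail_meet:
  assumes "triangular k l m"
  shows "strict_mono_on {1..k} (tail_meet k m)"
proof (rule strict_mono_onI)
  fix i j assume ij: "i \<in> {1..k}" "j \<in> {1..k}" "i < j"
  have "tail_meet k m i \<le> tail_meet k m j" using ij by (intro tail_meet_mono) auto
  moreover have "tail_meet k m i \<noteq> tail_meet k m j"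
    using not_le_tail_meet[OF assms ij(1)] le_later_tail_meet[OF assms ij] by metis
  ultimately show "tail_meet k m i < tail_meet k m j" by simp
qed

lemma le_tail_meet_chain:
  assumes "triangular k l m" and "i \<in> {1..k}"
  shows "l i \<le> tail_meet_chain k m i"
  using le_later_tail_meet[OF assms, of "Suc i"] assms(2) by (auto simp: tail_meet_chain_def)

lemma triangular_tail_meet_chain:
  assumes tri: "triangular k l m"
  shows "triangular k (tail_meet_chain k m) (tail_meet k m)"
  unfolding triangular_def
proof (intro conjI ballI impI)
  fix i assume "i \<in> {1..k}"
  thus "\<not> tail_meet_chain k m i \<le> tail_meet k m i"
    using le_tail_meet_chain[OF tri] not_le_tail_meet[OF tri] order_trans by blast
next
  fix i j assume "i \<in> {1..k}" "j \<in> {1..k}" "i < j"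
  thus "tail_meet_chain k m i \<le> tail_meet k m j"
    by (auto simp: tail_meet_chain_def intro: tail_meet_mono)
qed

lemma chain_tail_meet_chain:
  "Complete_Partial_Order.chain (\<le>) (tail_meet_chain k m ` {1..k})"
proof -
  have mono: "tail_meet_chain k m i \<le> tail_meet_chain k m j" if "i \<le> j" for i j
    using that by (auto simp: tail_meet_chain_def intro: tail_meet_mono)
  show ?thesis
    unfolding chain_def
  proof (intro ballI; elim imageE; hypsubst)
    fix i j
    show "tail_meet_chain k m i \<le> tail_meet_chain k m j
        \<or> tail_meet_chain k m j \<le> tail_meet_chain k m i"
      using mono[of i j] mono[of j i] by (cases "i \<le> j") auto
  qed
qed

lemma push_tail_meet_chain:
  assumes tri: "triangular k l m"
  shows "push (l ` {1..k}) (tail_meet_chain k m ` {1..k}) (tail_meet k m ` {1..k})"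
  unfolding push_def
  using triangular_witness_listing[OF triangular_tail_meet_chain[OF tri]]
    le_tail_meet_chain[OF tri] not_le_tail_meet[OF tri] by blast

theorem proposition4p9:
  "(\<forall>W :: 'a::{finite, bounded_lattice_top} set.
      c_independent W \<longleftrightarrow>
      (\<exists>C U. Complete_Partial_Order.chain (\<le>) C \<and> c_independent C \<and> witness C U \<and> push W C U))
   \<and>
   (\<forall>k l m (W :: 'a set) U.
      c_independent W \<and> witness_listing k l m W U \<longrightarrow>
      strict_mono_on {1..k} (tail_meet k m) \<and>
      (\<forall>j\<in>{1..k}. tail_meet k m j < top) \<and>
      c_independent (tail_meet_chain k m ` {1..k}) \<and>
      witness_listing k (tail_meet_chain k m) (tail_meet k m)
        (tail_meet_chain k m ` {1..k}) (tail_meet k m ` {1..k}) \<and>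
      push W (tail_meet_chain k m ` {1..k}) (tail_meet k m ` {1..k}))"
proof (intro conjI allI impI)
  fix W :: "'a set"
  show "c_independent W \<longleftrightarrow>
      (\<exists>C U. Complete_Partial_Order.chain (\<le>) C \<and> c_independent C \<and> witness C U \<and> push W C U)"
  proof
    assume "c_independent W"
    then obtain k l m where tri: "triangular k l m" and W: "W = l ` {1..k}"
      using triangular_exists by metis
    let ?C = "tail_meet_chain k m ` {1..k}" and ?U = "tail_meet k m ` {1..k}"
    have triC: "triangular k (tail_meet_chain k m) (tail_meet k m)"
      by (rule triangular_tail_meet_chain[OF tri])
    have "witness ?C ?U"
      using triangular_witness_listing[OF triC] by (simp add: witness_listing_def)
    thus "\<exists>C U. Complete_Partial_Order.chain (\<le>) C \<and> c_independent C \<and> witness C U \<and> push W C U"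
      using chain_tail_meet_chain triangular_c_independent[OF triC] push_tail_meet_chain[OF tri] W
      by blast
  qed (blast intro: push_c_independent)
next
  fix k l m and W U :: "'a set"
  assume "c_independent W \<and> witness_listing k l m W U"
  hence tri: "triangular k l m" and W: "l ` {1..k} = W"
    using witness_listing_triangular by blast+
  have triC: "triangular k (tail_meet_chain k m) (tail_meet k m)"
    by (rule triangular_tail_meet_chain[OF tri])
  show "strict_mono_on {1..k} (tail_meet k m)" by (rule strict_mono_on_tail_meet[OF tri])
  show "c_independent (tail_meet_chain k m ` {1..k})" by (rule triangular_c_independent[OF triC])
  show "witness_listing k (tail_meet_chain k m) (tail_meet k m)
        (tail_meet_chain k m ` {1..k}) (tail_meet k m ` {1..k})"
    by (rule triangular_witness_listing[OF triC])
  show "push W (tail_meet_chain k m ` {1..k}) (tail_meet k m ` {1..k})"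
    using push_tail_meet_chain[OF tri] W by simp
  show "\<forall>j\<in>{1..k}. tail_meet k m j < top"
    using not_le_tail_meet[OF tri] top_greatest by (metis top.not_eq_extremum)
qed

end
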